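(* Let $\mathscr T=(V,\mathcal E)$ be the directed Cartesian product of leafless, rooted directed trees $\mathscr T_1,\ldots,\mathscr T_d$ and let $S_{\boldsymbol\lambda}=(S_1,\ldots,S_d)$ be a commuting multishift on $\mathscr T$. Consider the function $\mathfrak C:V\to(0,\infty)$ given by $$\mathfrak C(v):=\sum_{j=1}^d\|S_je_v\|^2,\quad v\in V.$$ If $d\geq 2$, then the following conditions are equivalent: (i) $\mathfrak C$ is constant on every generation $\mathcal G_t$, $t\in\mathbb N$. (ii) $\mathfrak C$ is constant on $\mathsf{Par}(v)$ for every $v\in V^\circ$.
   Context: $\mathbb N=\{0,1,2,\ldots\}$. A rooted directed tree is a connected directed graph without circuits in which every vertex has at most one parent and exactly one vertex (the root) has no parent; it is leafless if every vertex has at least one child. All directed trees are assumed countably infinite. $\mathsf{Chi}(u)$ is the set of children of $u$ and $\mathsf{par}(u)$ the parent of a non-root vertex $u$; the depth of $u$ is the length of the path from the root to $u$. For rooted directed trees $\mathscr T_j=(V_j,\mathcal E_j)$ with roots $\mathsf{root}_j$, the directed Cartesian product $\mathscr T=(V,\mathcal E)$ has $V=V_1\times\cdots\times V_d$ and $(v,w)\in\mathcal E$ iff there is $k$ with $v_j=w_j$ for $j\neq k$ and $(v_k,w_k)\in\mathcal E_k$. Put $\mathsf{root}=(\mathsf{root}_1,\ldots,\mathsf{root}_d)$, $V^\circ=V\setminus\{\mathsf{root}\}$. The depth of $v$ is $\mathsf d_v=(\mathsf d_{v_1},\ldots,\mathsf d_{v_d})$, $\mathsf d_{v_j}$ being the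 depth of $v_j$ in $\mathscr T_j$; $|\mathsf d_v|=\sum_j\mathsf d_{v_j}$; $\mathcal G_t=\{v\in V:|\mathsf d_v|=t\}$. $\mathsf{Chi}_j(v)$ is the set of $w\in V$ with $w_i=v_i$ for $i\neq j$ and $w_j\in\mathsf{Chi}(v_j)$. If $v_j\neq\mathsf{root}_j$, $\mathsf{par}_j(v)$ is $v$ with its $j$-th coordinate replaced by $\mathsf{par}(v_j)$ (and there is no $\mathsf{par}_j(v)$ if $v_j=\mathsf{root}_j$). $\mathsf{Par}(v)=\bigcup_{j=1}^d\mathsf{par}_j(v)$ is the set of all existing $\mathsf{par}_j(v)$, $j=1,\ldots,d$. Multishift: for a system $\boldsymbol\lambda=\{\lambda_j(v):v\in V^\circ,\ j=1,\ldots,d\}$ of positive numbers, $S_j$ acts in $l^2(V)$ by $(S_jf)(v)=\lambda_j(v)f(\mathsf{par}_j(v))$ if $v_j\neq\mathsf{root}_j$ and $0$ otherwise, so $S_je_v=\sum_{w\in\mathsf{Chi}_j(v)}\lambda_j(w)e_w$, where $e_v$ is the indicator function of $\{v\}$. $S_{\boldsymbol\lambda}=(S_1,\ldots,S_d)$ is a commuting multishift if all $S_j$ are bounded on $l^2(V)$, i.e. $\sup_{v\in V}\sum_{w\in\mathsf{Chi}_j(v)}\lambda_j(w)^2<\infty$, and $S_iS_j=S_jS_i$ for all $i,j$. *)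

theory Defs
  imports "HOL-Analysis.Analysis" "Graph_Theory.Graph_Theory"
begin

section \<open>Rooted directed trees\<close>

text \<open>Connectedness is that of the underlying undirected graph, whereas \<open>cycle\<close> refers to directed
  closed walks; it includes loops.\<close>

locale rooted_directed_tree = pair_wf_digraph T
  for T :: "'a pair_pre_digraph" +
  assumes tree_connected: "Digraph_Component.connected (with_proj T)"
    and no_circuit: "\<not> (\<exists>p. cycle p)"
    and parent_unique: "\<lbrakk>(u, w) \<in> parcs T; (v, w) \<in> parcs T\<rbrakk> \<Longrightarrow> u = v"
    and root_ex1: "\<exists>!r. r \<in> pverts T \<and> (\<forall>u. (u, r) \<notin> parcs T)"
    and verts_countable: "countable (pverts T)"
    and verts_infinite: "infinite (pverts T)"

definition children :: "'a pair_pre_digraph \<Rightarrow> 'a \<Rightarrow> 'a set" where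
  "children T u = {w. (u, w) \<in> parcs T}"

definition root_of :: "'a pair_pre_digraph \<Rightarrow> 'a" where
  "root_of T = (THE r. r \<in> pverts T \<and> (\<forall>u. (u, r) \<notin> parcs T))"

definition parent :: "'a pair_pre_digraph \<Rightarrow> 'a \<Rightarrow> 'a" where
  "parent T v = (THE u. (u, v) \<in> parcs T)"

definition depth :: "'a pair_pre_digraph \<Rightarrow> 'a \<Rightarrow> nat" where
  "depth T u = (THE n. \<exists>p. pre_digraph.apath (with_proj T) (root_of T) p u \<and> length p = n)"

locale leafless_rooted_directed_tree = rooted_directed_tree T
  for T :: "'a pair_pre_digraph" +
  assumes leafless: "u \<in> pverts T \<Longrightarrow> children T u \<noteq> {}"

section \<open>Directed Cartesian products\<close>

text \<open>The factors are indexed by a finite type \<open>'d\<close>, so that \<open>d = CARD('d)\<close>. They share the type \<open>'a\<close>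
  of vertices, but each factor has its own vertex set in it.\<close>

definition cart_prod :: "('d::finite \<Rightarrow> 'a pair_pre_digraph) \<Rightarrow> ('d \<Rightarrow> 'a) pair_pre_digraph" where
  "cart_prod T =
     \<lparr>pverts = {v. \<forall>j. v j \<in> pverts (T j)},
      parcs = {(v, w). (\<forall>j. v j \<in> pverts (T j)) \<and> (\<forall>j. w j \<in> pverts (T j)) \<and>
                 (\<exists>k. (\<forall>j. j \<noteq> k \<longrightarrow> v j = w j) \<and> (v k, w k) \<in> parcs (T k))}\<rparr>"

definition prod_root :: "('d::finite \<Rightarrow> 'a pair_pre_digraph) \<Rightarrow> 'd \<Rightarrow> 'a" where
  "prod_root T = (\<lambda>j. root_of (T j))"

definition nonroot_verts :: "('d::finite \<Rightarrow> 'a pair_pre_digraph) \<Rightarrow> ('d \<Rightarrow> 'a) set" where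
  "nonroot_verts T = pverts (cart_prod T) - {prod_root T}"

definition total_depth :: "('d::finite \<Rightarrow> 'a pair_pre_digraph) \<Rightarrow> ('d \<Rightarrow> 'a) \<Rightarrow> nat" where
  "total_depth T v = (\<Sum>j\<in>UNIV. depth (T j) (v j))"

definition generation :: "('d::finite \<Rightarrow> 'a pair_pre_digraph) \<Rightarrow> nat \<Rightarrow> ('d \<Rightarrow> 'a) set" where
  "generation T t = {v \<in> pverts (cart_prod T). total_depth T v = t}"

text \<open>Meaningful only if \<open>v j\<close> is not the root of the \<open>j\<close>-th factor; all uses are guarded.\<close>

definition par_coord :: "('d::finite \<Rightarrow> 'a pair_pre_digraph) \<Rightarrow> 'd \<Rightarrow> ('d \<Rightarrow> 'a) \<Rightarrow> ('d \<Rightarrow> 'a)" where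
  "par_coord T j v = v(j := parent (T j) (v j))"

definition Par :: "('d::finite \<Rightarrow> 'a pair_pre_digraph) \<Rightarrow> ('d \<Rightarrow> 'a) \<Rightarrow> ('d \<Rightarrow> 'a) set" where
  "Par T v = {par_coord T j v | j. v j \<noteq> root_of (T j)}"

section \<open>Operators on square-summable functions\<close>

text \<open>\<open>ell2 X\<close> consists of functions on the whole type that vanish outside \<open>X\<close>.\<close>

definition ell2 :: "'b set \<Rightarrow> ('b \<Rightarrow> complex) set" where
  "ell2 X = {f. (\<forall>x. x \<notin> X \<longrightarrow> f x = 0) \<and> (\<lambda>x. (cmod (f x))\<^sup>2) summable_on X}"

definition ell2_norm :: "'b set \<Rightarrow> ('b \<Rightarrow> complex) \<Rightarrow> real" where
  "ell2_norm X f = sqrt (\<Sum>\<^sub>\<infinity>x\<in>X. (cmod (f x))\<^sup>2)"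

definition bounded_on_ell2 :: "'b set \<Rightarrow> (('b \<Rightarrow> complex) \<Rightarrow> ('b \<Rightarrow> complex)) \<Rightarrow> bool" where
  "bounded_on_ell2 X A \<longleftrightarrow>
     (\<forall>f\<in>ell2 X. A f \<in> ell2 X) \<and> (\<exists>C. \<forall>f\<in>ell2 X. ell2_norm X (A f) \<le> C * ell2_norm X f)"

section \<open>Commuting multishifts\<close>

definition multishift ::
  "('d::finite \<Rightarrow> 'a pair_pre_digraph) \<Rightarrow> ('d \<Rightarrow> ('d \<Rightarrow> 'a) \<Rightarrow> real) \<Rightarrow> 'd
     \<Rightarrow> (('d \<Rightarrow> 'a) \<Rightarrow> complex) \<Rightarrow> (('d \<Rightarrow> 'a) \<Rightarrow> complex)" where
  "multishift T lam j f v =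
     (if v \<in> pverts (cart_prod T) \<and> v j \<noteq> root_of (T j)
      then complex_of_real (lam j v) * f (par_coord T j v) else 0)"

definition commuting_multishift ::
  "('d::finite \<Rightarrow> 'a pair_pre_digraph) \<Rightarrow> ('d \<Rightarrow> ('d \<Rightarrow> 'a) \<Rightarrow> real) \<Rightarrow> bool" where
  "commuting_multishift T lam \<longleftrightarrow>
     (\<forall>j. \<forall>v\<in>nonroot_verts T. lam j v > 0) \<and>
     (\<forall>j. bounded_on_ell2 (pverts (cart_prod T)) (multishift T lam j)) \<and>
     (\<forall>i j. \<forall>f\<in>ell2 (pverts (cart_prod T)).
        multishift T lam i (multishift T lam j f) = multishift T lam j (multishift T lam i f))"

definition sum_norm_sq ::
  "('d::finite \<Rightarrow> 'a pair_pre_digraph) \<Rightarrow> ('d \<Rightarrow> ('d \<Rightarrow> 'a) \<Rightarrow> real) \<Rightarrow> ('d \<Rightarrow> 'a) \<Rightarrow> real" where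
  "sum_norm_sq T lam v =
     (\<Sum>j\<in>UNIV. (ell2_norm (pverts (cart_prod T)) (multishift T lam j (indicator {v})))\<^sup>2)"

end

theory Submission
  imports Defs
begin

text \<open>Only the combinatorics of the product matters: for \<open>i \<noteq> j\<close>, passing to the parent in
  coordinate \<open>i\<close> and to some child in coordinate \<open>j\<close> turns a vertex into one with which it shares
  a child, so a function constant on each \<open>Par v\<close> is invariant under such moves. Leaflessness allows
  the whole depth of a vertex to be shifted into a single coordinate \<open>b\<close>. Finally, for two coordinates
  \<open>a \<noteq> b\<close>, climbing from \<open>x\<close> to the root in coordinate \<open>a\<close> while descending from the root to \<open>y\<close> in
  coordinate \<open>b\<close> identifies every \<open>x\<close> with every \<open>y\<close> of the same depth, so that all vertices of a
  generation are identified.\<close>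

section \<open>Walks from the root and depth in a single tree\<close>

context rooted_directed_tree
begin

lemma root_in_verts: "root_of T \<in> pverts T"
  and no_arc_to_root: "(u, root_of T) \<notin> parcs T"
  using theI'[OF root_ex1] by (auto simp: root_of_def)

lemma parent_eqI: "(u, v) \<in> parcs T \<Longrightarrow> parent T v = u"
  unfolding parent_def using parent_unique by blast

lemma parent_arc:
  assumes "v \<in> pverts T" "v \<noteq> root_of T"
  shows "(parent T v, v) \<in> parcs T"
proof -
  obtain u where "(u, v) \<in> parcs T"
    using assms root_ex1 root_in_verts no_arc_to_root by blast
  then show ?thesis using parent_eqI by simp
qed

text \<open>Uniqueness of parents determines the last arc of a walk, not the first, so walks are
  taken apart from the end.\<close>

lemma awalk_snoc_iff:
  "awalk u (p @ [e]) w \<longleftrightarrow> awalk u p (fst e) \<and> e \<in> parcs T \<and> snd e = w"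
proof
  assume "awalk u (p @ [e]) w"
  then show "awalk u p (fst e) \<and> e \<in> parcs T \<and> snd e = w"
    by (auto simp: awalk_Cons_iff awalk_Nil_iff)
next
  assume *: "awalk u p (fst e) \<and> e \<in> parcs T \<and> snd e = w"
  then have "awalk (fst e) [e] w"
    using arc_snd_in_verts by (auto simp: awalk_Cons_iff awalk_Nil_iff)
  then show "awalk u (p @ [e]) w" using * awalk_appendI by blast
qed

text \<open>Follow an undirected path from the root. A forward arc extends the walk found so far. A
  backward arc \<open>(w, v)\<close> must be the last arc of that walk, since \<open>v\<close> has
  only one parent, and deleting it leaves a walk to \<open>w\<close>.\<close>

lemma ex_awalk_from_root:
  assumes "v \<in> pverts T"
  shows "\<exists>p. awalk (root_of T) p v"
proof -
  let ?E = "parcs (mk_symmetric (with_proj T))"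
  have "(root_of T, v) \<in> rtrancl_on (pverts T) ?E"
    using tree_connected assms root_in_verts
    unfolding connected_def strongly_connected_def reachable_def by auto
  then show ?thesis
  proof (induction rule: rtrancl_on_induct)
    case base
    then show ?case using root_in_verts by (auto simp: awalk_Nil_iff intro!: exI[of _ "[]"])
  next
    case (step v w)
    then obtain p where p: "awalk (root_of T) p v" by blast
    from step have "(v, w) \<in> parcs T \<or> (w, v) \<in> parcs T"
      by (auto simp: parcs_mk_symmetric)
    then show ?case
    proof
      assume "(v, w) \<in> parcs T"
      then have "awalk (root_of T) (p @ [(v, w)]) w" using p by (simp add: awalk_snoc_iff del: awalk_append_iff)
      then show ?thesis by blast
    next
      assume wv: "(w, v) \<in> parcs T"
      show ?thesis
      proof (cases p rule: rev_cases)
        case Nil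
        then show ?thesis using p wv no_arc_to_root by (auto simp: awalk_Nil_iff)
      next
        case (snoc q e)
        then have "awalk (root_of T) q (fst e)" "(fst e, v) \<in> parcs T"
          using p by (auto simp: awalk_snoc_iff simp del: awalk_append_iff)
        then show ?thesis using parent_unique wv by blast
      qed
    qed
  qed
qed

text \<open>Traced backwards from \<open>v\<close>, both walks are forced by uniqueness of parents,
  and they stop together because no arc enters the root.\<close>

lemma awalk_from_root_length_unique:
  "awalk (root_of T) p v \<Longrightarrow> awalk (root_of T) q v \<Longrightarrow> length p = length q"
proof (induction p arbitrary: v q rule: rev_induct)
  case Nil
  then show ?case using no_arc_to_root
    by (cases q rule: rev_cases) (auto simp: awalk_snoc_iff awalk_Nil_iff simp del: awalk_append_iff)
next
  case (snoc e p)
  then have e: "awalk (root_of T) p (fst e)" "(fst e, v) \<in> parcs T"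
    by (auto simp: awalk_snoc_iff simp del: awalk_append_iff)
  show ?case
  proof (cases q rule: rev_cases)
    case Nil
    then show ?thesis using snoc.prems e no_arc_to_root by (auto simp: awalk_Nil_iff)
  next
    case q: (snoc q' e')
    then have e': "awalk (root_of T) q' (fst e')" "(fst e', v) \<in> parcs T"
      using snoc.prems(2) by (metis awalk_snoc_iff prod.collapse)+
    then have "fst e' = fst e" using e parent_unique by blast
    then show ?thesis using snoc.IH[OF e(1)] e'(1) q by simp
  qed
qed

text \<open>Frees \<open>depth\<close> from \<open>apath\<close>: walks can be extended without
  checking for repeated vertices, and shortening one to a path cannot change its length.\<close>

lemma depth_eq_length:
  assumes "awalk (root_of T) p v"
  shows "depth T v = length p"
proof -
  have "apath (root_of T) (awalk_to_apath p) v"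
    using assms by (rule apath_awalk_to_apath)
  then show ?thesis
    unfolding depth_def
    using awalk_from_root_length_unique[OF assms] awalkI_apath
    by (intro the_equality) metis+
qed

lemma depth_root: "depth T (root_of T) = 0"
  using depth_eq_length[of "[]"] root_in_verts by (simp add: awalk_Nil_iff)

lemma depth_arc:
  assumes "(u, v) \<in> parcs T"
  shows "depth T v = Suc (depth T u)"
proof -
  obtain p where p: "awalk (root_of T) p u"
    using ex_awalk_from_root in_arcsD1[OF assms] by blast
  then have "awalk (root_of T) (p @ [(u, v)]) v"
    using assms by (simp add: awalk_snoc_iff del: awalk_append_iff)
  then have "depth T v = length (p @ [(u, v)])" by (rule depth_eq_length)
  then show ?thesis using depth_eq_length[OF p] by simp
qed

lemma depth_eq_0_iff: "v \<in> pverts T \<Longrightarrow> depth T v = 0 \<longleftrightarrow> v = root_of T"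
  by (metis depth_root depth_arc parent_arc nat.distinct(1))

text \<open>The bound on \<open>n\<close> keeps the iteration from going past the root, where
  \<open>parent\<close> is unspecified.\<close>

lemma parent_iterate:
  assumes "v \<in> pverts T" "n \<le> depth T v"
  shows "(parent T ^^ n) v \<in> pverts T \<and> depth T ((parent T ^^ n) v) = depth T v - n"
  using assms(2)
proof (induction n)
  case 0
  then show ?case using assms(1) by simp
next
  case (Suc n)
  let ?u = "(parent T ^^ n) v"
  have u: "?u \<in> pverts T" "depth T ?u = depth T v - n" using Suc by auto
  then have "?u \<noteq> root_of T" using Suc.prems depth_root by auto
  then have "(parent T ?u, ?u) \<in> parcs T" using parent_arc u by blast
  then show ?case using u depth_arc[of "parent T ?u" ?u] in_arcsD1 Suc.prems by auto
qed

end

section \<open>Depth and parents in the directed Cartesian product\<close>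

locale leafless_tree_product =
  fixes T :: "'d::finite \<Rightarrow> 'a pair_pre_digraph"
  assumes trees: "leafless_rooted_directed_tree (T j)"

sublocale leafless_tree_product \<subseteq> tree: leafless_rooted_directed_tree "T j" for j
  by (rule trees)

context leafless_tree_product
begin

lemma in_cart_prod: "v \<in> pverts (cart_prod T) \<longleftrightarrow> (\<forall>j. v j \<in> pverts (T j))"
  by (simp add: cart_prod_def)

text \<open>The additive form avoids truncated subtraction.\<close>

lemma total_depth_update:
  "total_depth T (v(j := x)) + depth (T j) (v j) = total_depth T v + depth (T j) x"
proof -
  have "(\<Sum>i\<in>UNIV - {j}. depth (T i) ((v(j := x)) i)) = (\<Sum>i\<in>UNIV - {j}. depth (T i) (v i))"
    by (rule sum.cong) auto
  then show ?thesis
    unfolding total_depth_def by (simp add: sum.remove[of UNIV j])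
qed

lemma total_depth_par_coord:
  assumes "v \<in> pverts (cart_prod T)" "v j \<noteq> root_of (T j)"
  shows "Suc (total_depth T (par_coord T j v)) = total_depth T v"
  using total_depth_update[of v j "parent (T j) (v j)"]
    tree.depth_arc[OF tree.parent_arc, of "v j" j] assms
  by (simp add: par_coord_def in_cart_prod)

lemma par_coord_in_cart_prod:
  assumes "v \<in> pverts (cart_prod T)" "v j \<noteq> root_of (T j)"
  shows "par_coord T j v \<in> pverts (cart_prod T)"
  using assms tree.in_arcsD1[OF tree.parent_arc, of "v j" j]
  by (simp add: par_coord_def in_cart_prod)

text \<open>This yields the implication from (i) to (ii). The truncation at depth 0 is harmless, as
  only the root has depth 0 and its \<open>Par\<close> is empty.\<close>

lemma Par_subset_generation:
  assumes "v \<in> pverts (cart_prod T)"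
  shows "Par T v \<subseteq> generation T (total_depth T v - 1)"
proof
  fix w assume "w \<in> Par T v"
  then obtain j where j: "v j \<noteq> root_of (T j)" and w: "w = par_coord T j v"
    by (auto simp: Par_def)
  show "w \<in> generation T (total_depth T v - 1)"
    using par_coord_in_cart_prod[OF assms j] total_depth_par_coord[OF assms j]
    by (simp add: w generation_def)
qed

definition two_coord :: "'d \<Rightarrow> 'd \<Rightarrow> 'a \<Rightarrow> 'a \<Rightarrow> 'd \<Rightarrow> 'a" where
  "two_coord a b x y = (prod_root T)(a := x, b := y)"

section \<open>Functions constant on every \<open>Par T v\<close>\<close>

context
  fixes F :: "('d \<Rightarrow> 'a) \<Rightarrow> 'c"
  assumes F_Par: "v \<in> nonroot_verts T \<Longrightarrow> F constant_on Par T v"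
begin

text \<open>Both vertices are parents of \<open>v(k := c)\<close>.\<close>

lemma exchange_step:
  assumes v: "v \<in> pverts (cart_prod T)" and j: "v j \<noteq> root_of (T j)"
    and jk: "j \<noteq> k" and c: "(v k, c) \<in> parcs (T k)"
  shows "F (v(j := parent (T j) (v j), k := c)) = F v"
proof -
  let ?w = "v(k := c)"
  have "c \<noteq> root_of (T k)" using c tree.no_arc_to_root by blast
  moreover have "?w \<in> pverts (cart_prod T)"
    using v tree.in_arcsD2[OF c] by (simp add: in_cart_prod)
  ultimately have w: "?w \<in> nonroot_verts T"
    by (auto simp: nonroot_verts_def prod_root_def fun_eq_iff)
  have "par_coord T k ?w = v"
    using tree.parent_eqI[OF c] by (simp add: par_coord_def)
  then have 1: "v \<in> Par T ?w"
    using \<open>c \<noteq> root_of (T k)\<close> by (force simp: Par_def)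
  have "par_coord T j ?w = v(j := parent (T j) (v j), k := c)"
    using jk by (auto simp: par_coord_def)
  then have 2: "v(j := parent (T j) (v j), k := c) \<in> Par T ?w"
    using j jk by (force simp: Par_def)
  from F_Par[OF w] 1 2 show ?thesis by (auto simp: constant_on_def)
qed

text \<open>Induction on the depth lying outside coordinate \<open>b\<close>: each exchange takes
  one unit from some \<open>j\<close> \<noteq> \<open>b\<close> and gives it to
  \<open>b\<close>.\<close>

lemma shift_to_coord:
  assumes "v \<in> pverts (cart_prod T)"
  shows "\<exists>y\<in>pverts (T b). depth (T b) y = total_depth T v \<and> F v = F ((prod_root T)(b := y))"
  using assms
proof (induction "total_depth T v - depth (T b) (v b)" arbitrary: v rule: less_induct)
  case less
  note v = less.prems
  show ?case
  proof (cases "\<exists>j. j \<noteq> b \<and> v j \<noteq> root_of (T j)")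
    case True
    then obtain j where j: "j \<noteq> b" "v j \<noteq> root_of (T j)" by blast
    obtain c where c: "(v b, c) \<in> parcs (T b)"
      using tree.leafless[of "v b" b] v by (auto simp: children_def in_cart_prod)
    let ?u = "v(j := parent (T j) (v j))"
    let ?w = "?u(b := c)"
    have u: "?u \<in> pverts (cart_prod T)"
      using par_coord_in_cart_prod[OF v j(2)] by (simp add: par_coord_def)
    have w: "?w \<in> pverts (cart_prod T)"
      using u tree.in_arcsD2[OF c] by (simp add: in_cart_prod)
    have d: "Suc (total_depth T ?u) = total_depth T v"
      using total_depth_par_coord[OF v j(2)] by (simp add: par_coord_def)
    have dw: "total_depth T ?w = total_depth T v"
      using total_depth_update[of ?u b c] tree.depth_arc[OF c] d j(1) by simp
    \<comment> \<open>Together with \<open>d\<close>, this makes the measure of \<open>v\<close>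
      positive, so that the truncated difference really drops.\<close>
    have "depth (T b) (?u b) \<le> total_depth T ?u"
      unfolding total_depth_def by (rule member_le_sum) auto
    then have "total_depth T ?w - depth (T b) (?w b) < total_depth T v - depth (T b) (v b)"
      using dw d tree.depth_arc[OF c] j(1) by simp
    then obtain y where "y \<in> pverts (T b)" "depth (T b) y = total_depth T ?w"
      "F ?w = F ((prod_root T)(b := y))"
      using less.hyps[OF _ w] by blast
    then show ?thesis using exchange_step[OF v j(2,1) c] dw by auto
  next
    case False
    then have eq: "v = (prod_root T)(b := v b)"
      by (auto simp: prod_root_def fun_eq_iff)
    have "total_depth T v = depth (T b) (v b)"
      unfolding total_depth_def using False tree.depth_root
      by (subst sum.remove[of _ b]) (auto intro!: sum.neutral)
    then show ?thesis using eq v by (metis in_cart_prod)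
  qed
qed

lemma one_coord_eq:
  assumes ab: "a \<noteq> b" and x: "x \<in> pverts (T a)" and y: "y \<in> pverts (T b)"
    and d: "depth (T a) x = depth (T b) y"
  shows "F ((prod_root T)(a := x)) = F ((prod_root T)(b := y))"
proof -
  define t where "t = depth (T a) x"
  define X where "X n = (parent (T a) ^^ n) x" for n
  define Y where "Y n = (parent (T b) ^^ n) y" for n
  have X: "X n \<in> pverts (T a)" "depth (T a) (X n) = t - n" if "n \<le> t" for n
    using tree.parent_iterate[OF x, of n] that by (auto simp: X_def t_def)
  have Y: "Y n \<in> pverts (T b)" "depth (T b) (Y n) = t - n" if "n \<le> t" for n
    using tree.parent_iterate[OF y, of n] that d by (auto simp: Y_def t_def)
  \<comment> \<open>The depths are \<open>t - n\<close> in coordinate \<open>a\<close> and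
    \<open>n\<close> in coordinate \<open>b\<close>, so the total stays \<open>t\<close>;
    \<open>n = 0\<close> gives \<open>x\<close> beside the root, \<open>n = t\<close> the root
    beside \<open>y\<close>.\<close>
  have "F (two_coord a b (X n) (Y (t - n))) = F (two_coord a b (X 0) (Y t))" if "n \<le> t" for n
    using that
  proof (induction n)
    case 0
    then show ?case by simp
  next
    case (Suc n)
    let ?v = "two_coord a b (X n) (Y (t - n))"
    have Xn: "X n \<noteq> root_of (T a)"
      using X(2)[of n] tree.depth_root[of a] Suc.prems by fastforce
    have Yn: "Y (t - Suc n) \<noteq> root_of (T b)"
      using Y(2)[of "t - Suc n"] tree.depth_root[of b] Suc.prems by fastforce
    \<comment> \<open>Read backwards, the ancestors of \<open>y\<close> prescribe which child to
      descend to, so that the descent ends at \<open>y\<close> itself.\<close>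
    have "Suc (t - Suc n) = t - n" using Suc.prems by simp
    then have "parent (T b) (Y (t - Suc n)) = Y (t - n)"
      unfolding Y_def by (metis comp_apply funpow.simps(2))
    then have arc: "(?v b, Y (t - Suc n)) \<in> parcs (T b)"
      using tree.parent_arc[OF Y(1) Yn] by (simp add: two_coord_def)
    have v: "?v \<in> pverts (cart_prod T)"
      using X(1) Y(1) tree.root_in_verts Suc.prems
      by (auto simp: in_cart_prod two_coord_def prod_root_def)
    have "?v(a := parent (T a) (?v a), b := Y (t - Suc n)) =
        two_coord a b (X (Suc n)) (Y (t - Suc n))"
      using ab by (auto simp: two_coord_def X_def fun_eq_iff)
    moreover have "?v a \<noteq> root_of (T a)" using Xn ab by (simp add: two_coord_def)
    ultimately have "F (two_coord a b (X (Suc n)) (Y (t - Suc n))) = F ?v"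
      using exchange_step[OF v _ ab arc] by simp
    then show ?case using Suc by simp
  qed
  from this[of t] have *: "F (two_coord a b (X t) (Y 0)) = F (two_coord a b (X 0) (Y t))"
    by simp
  have "X t = root_of (T a)" "Y t = root_of (T b)"
    using X[of t] Y[of t] tree.depth_eq_0_iff by auto
  then have "two_coord a b (X t) (Y 0) = (prod_root T)(b := y)"
    "two_coord a b (X 0) (Y t) = (prod_root T)(a := x)"
    using ab by (auto simp: two_coord_def prod_root_def X_def Y_def fun_eq_iff)
  then show ?thesis using * by simp
qed

lemma constant_on_generation:
  assumes "CARD('d) \<ge> 2"
  shows "F constant_on generation T t"
proof -
  obtain a b :: 'd where ab: "a \<noteq> b"
    using assms card_le_Suc0_iff_eq[of "UNIV :: 'd set"] by fastforce
  have "F v = F w" if "v \<in> generation T t" "w \<in> generation T t" for v w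
  proof -
    have "v \<in> pverts (cart_prod T)" "w \<in> pverts (cart_prod T)"
      and t: "total_depth T v = t" "total_depth T w = t"
      using that by (auto simp: generation_def)
    \<comment> \<open>The two vertices are pushed into different coordinates, so that
      \<open>one_coord_eq\<close> compares the results directly.\<close>
    from shift_to_coord[OF this(1), of a] shift_to_coord[OF this(2), of b] one_coord_eq[OF ab] t
    show ?thesis by metis
  qed
  then show ?thesis unfolding constant_on_def by metis
qed

end

lemma constant_on_generation_iff:
  assumes "CARD('d) \<ge> 2"
  shows "(\<forall>t. F constant_on generation T t) \<longleftrightarrow> (\<forall>v\<in>nonroot_verts T. F constant_on Par T v)"
proof
  assume "\<forall>t. F constant_on generation T t"
  then show "\<forall>v\<in>nonroot_verts T. F constant_on Par T v"
    using constant_on_subset[OF _ Par_subset_generation] unfolding nonroot_verts_def by blast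
next
  assume "\<forall>v\<in>nonroot_verts T. F constant_on Par T v"
  then show "\<forall>t. F constant_on generation T t"
    by (intro allI constant_on_generation assms) simp
qed

end

theorem theoremA:
  fixes T :: "'d::finite \<Rightarrow> 'a pair_pre_digraph"
    and lam :: "'d \<Rightarrow> ('d \<Rightarrow> 'a) \<Rightarrow> real"
  assumes "\<And>j. leafless_rooted_directed_tree (T j)"
    and "commuting_multishift T lam"
    and "CARD('d) \<ge> 2"
  shows "(\<forall>t::nat. sum_norm_sq T lam constant_on generation T t) \<longleftrightarrow>
         (\<forall>v\<in>nonroot_verts T. sum_norm_sq T lam constant_on Par T v)"
proof -
  interpret leafless_tree_product T
    by (rule leafless_tree_product.intro) (rule assms(1))
  show ?thesis by (rule constant_on_generation_iff[OF assms(3)])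
qed

end
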